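(* Let $\Delta$ be a pure two-dimensional simplicial complex on $5$ vertices. Then the following are equivalent: (a) $I_\Delta^{(m)}=I_\Delta^m$ for some $m\ge 2$; (b) $I_\Delta^{(m)}=I_\Delta^m$ for all $m\ge 2$; (c) the vertex set can be partitioned into two nonfaces of $\Delta$, one of two vertices and one of three vertices.
   Context: Let $K$ be a field and $R=K[x_1,\dots,x_n]$. A simplicial complex $\Delta$ on the vertex set $[n]=\{1,\dots,n\}$ is assumed to satisfy $\{i\}\in\Delta$ for every $i\in[n]$. A facet is a maximal face; $\mathcal F(\Delta)$ is the set of facets; $\Delta$ is pure if all facets have the same dimension. A nonface is a subset of $[n]$ not belonging to $\Delta$. The Stanley-Reisner ideal is $I_\Delta=(x_{i_1}\cdots x_{i_s} : \{i_1,\dots,i_s\}\notin\Delta)$. The $m$-th symbolic power is $I_\Delta^{(m)}=\bigcap_{F\in\mathcal F(\Delta)}P_F^m$, where $P_F=(x_i : i\notin F)$. *)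

theory Defs
  imports
    "HOL-Algebra.Ideal_Product"
    "HOL-Algebra.Algebraic_Closure_Type"
    "HOL-Library.Poly_Mapping"
    "HOL-Library.Cardinality"
begin

text \<open>
  Polynomials over \<open>'k\<close> with one variable for each element of \<open>'v\<close>: finitely supported maps from
  exponent vectors to coefficients, with the convolution product. For a field \<open>'k\<close> and a finite
  type \<open>'v\<close> with \<open>n\<close> elements this is \<open>K[x\<^sub>1, \<dots>, x\<^sub>n]\<close>.
\<close>

type_synonym ('v, 'k) mpoly = "('v \<Rightarrow>\<^sub>0 nat) \<Rightarrow>\<^sub>0 'k"

text \<open>
  The same ring as a HOL-Algebra structure, for generated ideals (\<open>Idl\<close>) and for powers of
  ideals, which are powers in the multiplicative monoid \<open>ideals_set\<close>.
\<close>

definition mpoly_ring :: "('v, 'k::field) mpoly ring" where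
  "mpoly_ring = ring_of_type_algebra"

definition indet :: "'v \<Rightarrow> ('v, 'k::field) mpoly" where
  "indet i = Poly_Mapping.single (Poly_Mapping.single i 1) 1"

definition ideal_power :: "('v, 'k::field) mpoly set \<Rightarrow> nat \<Rightarrow> ('v, 'k) mpoly set" where
  "ideal_power I m = I [^]\<^bsub>ideals_set mpoly_ring\<^esub> m"

text \<open>The vertex set is the whole type \<open>'v\<close>.\<close>

definition simplicial_complex :: "'v::finite set set \<Rightarrow> bool" where
  "simplicial_complex \<Delta> \<longleftrightarrow>
     (\<forall>F\<in>\<Delta>. \<forall>G. G \<subseteq> F \<longrightarrow> G \<in> \<Delta>) \<and> (\<forall>i. {i} \<in> \<Delta>)"

definition facets :: "'v::finite set set \<Rightarrow> 'v set set" where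
  "facets \<Delta> = {F \<in> \<Delta>. \<forall>G\<in>\<Delta>. F \<subseteq> G \<longrightarrow> G = F}"

definition face_dim :: "'v set \<Rightarrow> int" where
  "face_dim F = int (card F) - 1"

definition complex_dim :: "'v::finite set set \<Rightarrow> int" where
  "complex_dim \<Delta> = Max (face_dim ` \<Delta>)"

definition pure_complex :: "'v::finite set set \<Rightarrow> bool" where
  "pure_complex \<Delta> \<longleftrightarrow> (\<forall>F\<in>facets \<Delta>. \<forall>G\<in>facets \<Delta>. face_dim F = face_dim G)"

definition stanley_reisner_ideal :: "'v::finite set set \<Rightarrow> ('v, 'k::field) mpoly set" where
  "stanley_reisner_ideal \<Delta> = Idl\<^bsub>mpoly_ring\<^esub> {\<Prod>i\<in>S. indet i | S. S \<notin> \<Delta>}"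

definition facet_ideal :: "'v set \<Rightarrow> ('v, 'k::field) mpoly set" where
  "facet_ideal F = Idl\<^bsub>mpoly_ring\<^esub> {indet i | i. i \<notin> F}"

text \<open>The argument \<open>\<Delta>\<close> stands for its Stanley-Reisner ideal \<open>I\<close>: this is \<open>I\<^sup>(\<^sup>m\<^sup>)\<close>.\<close>

definition symbolic_power :: "'v::finite set set \<Rightarrow> nat \<Rightarrow> ('v, 'k::field) mpoly set" where
  "symbolic_power \<Delta> m = (\<Inter>F\<in>facets \<Delta>. ideal_power (facet_ideal F) m)"

end

theory Submission
  imports Defs
begin

text \<open>
  The complements of the facets are the edges of a graph \<open>G\<close> on the five vertices, and the nonfaces
  are the vertex covers of \<open>G\<close>. Hence (c) says that \<open>G\<close> is bipartite, and a monomial \<open>x\<^sup>u\<close> lies in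
  the \<open>m\<close>-th symbolic power iff \<open>u\<^sub>i + u\<^sub>j \<ge> m\<close> for every edge \<open>ij\<close>.
  If \<open>G\<close> is bipartite with parts \<open>A\<close>, \<open>B\<close> and \<open>u\<^sub>i + u\<^sub>j \<ge> m + 1\<close> on edges, then the vertices of \<open>A\<close>
  with \<open>u\<^sub>i \<ge> 1\<close> and those of \<open>B\<close> with \<open>u\<^sub>j \<ge> m + 1\<close> form a cover, and removing it from \<open>u\<close> leaves
  a monomial of the \<open>m\<close>-th symbolic power.
  Otherwise \<open>G\<close> contains a triangle or an induced pentagon \<open>W\<close>, of size \<open>2t - 1\<close>. Every cover has
  at least \<open>t\<close> vertices in \<open>W\<close>, so ordinary \<open>m\<close>-th powers have degree at least \<open>mt\<close> in \<open>W\<close>;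
  exponents close to \<open>m/2\<close> on \<open>W\<close> give a monomial in the symbolic power of smaller degree.
\<close>

section \<open>The polynomial ring and powers of its ideals\<close>

lemma mpoly_ring_simps [simp]:
  "carrier mpoly_ring = UNIV"
  "p \<otimes>\<^bsub>mpoly_ring\<^esub> q = p * q"
  "p \<oplus>\<^bsub>mpoly_ring\<^esub> q = p + q"
  "\<zero>\<^bsub>mpoly_ring\<^esub> = 0"
  "\<one>\<^bsub>mpoly_ring\<^esub> = 1"
  by (simp_all add: mpoly_ring_def ring_of_type_algebra_def)

lemma ring_mpoly_ring: "ring (mpoly_ring :: ('v, 'k::field) mpoly ring)"
  unfolding mpoly_ring_def by (rule ring_from_type_algebra)

text \<open>Closure under negation comes from multiplying by -1, and commutativity turns left
  absorption into right absorption.\<close>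

lemma ideal_mpoly_ring_iff:
  fixes I :: "('v, 'k::field) mpoly set"
  shows "ideal I mpoly_ring \<longleftrightarrow>
    0 \<in> I \<and> (\<forall>p\<in>I. \<forall>q\<in>I. p + q \<in> I) \<and> (\<forall>p\<in>I. \<forall>q. q * p \<in> I)"
    (is "_ \<longleftrightarrow> ?R")
proof
  assume "ideal I mpoly_ring"
  then interpret ideal I "mpoly_ring :: ('v, 'k) mpoly ring" .
  show ?R
    using additive_subgroup.zero_closed[OF is_additive_subgroup]
      additive_subgroup.a_closed[OF is_additive_subgroup] I_l_closed by simp
next
  interpret ring "mpoly_ring :: ('v, 'k) mpoly ring" by (rule ring_mpoly_ring)
  assume R: ?R
  have neg: "\<ominus>\<^bsub>mpoly_ring\<^esub> p = - p" for p :: "('v, 'k) mpoly"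
    by (rule minus_equality) auto
  have "- p \<in> I" if "p \<in> I" for p
    using R that by (metis mult_minus1)
  then have inv: "inv\<^bsub>add_monoid mpoly_ring\<^esub> p \<in> I" if "p \<in> I" for p
    using that neg[unfolded a_inv_def] by metis
  show "ideal I mpoly_ring"
  proof (rule idealI[OF ring_mpoly_ring])
    show "subgroup I (add_monoid mpoly_ring)"
      using R inv by (intro group.subgroupI[OF a_group]) auto
  qed (use R in \<open>auto simp: mult.commute\<close>)
qed

lemma ideal_mpoly_ring_sum:
  fixes I :: "('v, 'k::field) mpoly set"
  assumes "ideal I mpoly_ring" and "\<And>x. x \<in> T \<Longrightarrow> f x \<in> I"
  shows "(\<Sum>x\<in>T. f x) \<in> I"
  using assms unfolding ideal_mpoly_ring_iff by (induction T rule: infinite_finite_induct) auto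

lemma ideal_power_0: "ideal_power I 0 = UNIV"
  by (simp add: ideal_power_def ideals_set_def nat_pow_def)

lemma ideal_power_Suc: "ideal_power I (Suc m) = ideal_prod mpoly_ring (ideal_power I m) I"
  by (simp add: ideal_power_def ideals_set_def nat_pow_def)

lemma ideal_ideal_power:
  fixes I :: "('v, 'k::field) mpoly set"
  assumes "ideal I mpoly_ring"
  shows "ideal (ideal_power I m) mpoly_ring"
proof (induction m)
  case 0
  show ?case by (simp add: ideal_power_0 ideal_mpoly_ring_iff)
next
  case (Suc m)
  then show ?case
    unfolding ideal_power_Suc using assms by (rule ring.ideal_prod_is_ideal[OF ring_mpoly_ring])
qed

text \<open>A polynomial is the sum of its terms, and each term is a constant times a monomial. This
  reduces inclusions between ideals to statements about exponent vectors.\<close>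

lemma monomials_in_ideal:
  fixes I :: "('v, 'k::field) mpoly set"
  assumes I: "ideal I mpoly_ring"
    and mon: "\<And>u. u \<in> Poly_Mapping.keys p \<Longrightarrow> Poly_Mapping.single u 1 \<in> I"
  shows "p \<in> I"
proof -
  have p: "p = (\<Sum>u\<in>Poly_Mapping.keys p. Poly_Mapping.single u (Poly_Mapping.lookup p u))"
    by (rule poly_mapping_eqI) (simp add: lookup_sum lookup_single when_def in_keys_iff)
  have "Poly_Mapping.single u c \<in> I" if "u \<in> Poly_Mapping.keys p" for u c
  proof -
    have "Poly_Mapping.single u c = Poly_Mapping.single 0 c * Poly_Mapping.single u 1"
      by (simp add: mult_single)
    then show ?thesis
      using I mon[OF that] unfolding ideal_mpoly_ring_iff by metis
  qed
  then show ?thesis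
    by (subst p) (intro ideal_mpoly_ring_sum[OF I])
qed

section \<open>Degree bounds on a set of variables\<close>

definition set_exponent :: "'v set \<Rightarrow> 'v \<Rightarrow>\<^sub>0 nat" where
  "set_exponent S = (\<Sum>i\<in>S. Poly_Mapping.single i 1)"

lemma lookup_set_exponent:
  "finite S \<Longrightarrow> Poly_Mapping.lookup (set_exponent S) i = (if i \<in> S then 1 else 0)"
  by (simp add: set_exponent_def lookup_sum lookup_single when_def)

lemma prod_indet:
  "(\<Prod>i\<in>S. indet i) = Poly_Mapping.single (set_exponent S) 1"
  by (induction S rule: infinite_finite_induct) (simp_all add: set_exponent_def indet_def mult_single)

text \<open>For \<open>W\<close> the complement of a facet \<open>F\<close> this is the monomial description of \<open>P\<^sub>F\<^sup>n\<close>.\<close>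

definition weight_ideal :: "'v set \<Rightarrow> nat \<Rightarrow> ('v, 'k::field) mpoly set" where
  "weight_ideal W n = {p. \<forall>u\<in>Poly_Mapping.keys p. n \<le> sum (Poly_Mapping.lookup u) W}"

lemma weight_ideal_mult:
  assumes "p \<in> weight_ideal W a" "q \<in> weight_ideal W b"
  shows "p * q \<in> weight_ideal W (a + b)"
  using assms keys_mult[of p q] unfolding weight_ideal_def
  by (fastforce simp: lookup_add sum.distrib intro: add_mono)

lemma weight_ideal_add:
  assumes "p \<in> weight_ideal W a" "q \<in> weight_ideal W a"
  shows "p + q \<in> weight_ideal W a"
  using assms keys_add[of p q] unfolding weight_ideal_def by auto

lemma weight_ideal_0: "weight_ideal W 0 = UNIV"
  by (simp add: weight_ideal_def)

lemma ideal_weight_ideal: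
  "ideal (weight_ideal W n :: ('v, 'k::field) mpoly set) mpoly_ring"
  using weight_ideal_mult[of _ W 0 _ n] weight_ideal_add
  unfolding ideal_mpoly_ring_iff by (auto simp: weight_ideal_0) (simp add: weight_ideal_def)

text \<open>Degrees in the variables of \<open>W\<close> add up in products, and sums create no new
  monomials, so a lower bound \<open>d\<close> on \<open>I\<close> scales to \<open>m * d\<close> on
  the power.\<close>

lemma ideal_power_subset_weight_ideal:
  fixes I :: "('v, 'k::field) mpoly set"
  assumes "I \<subseteq> weight_ideal W d"
  shows "ideal_power I m \<subseteq> weight_ideal W (m * d)"
proof (induction m)
  case 0
  show ?case by (simp add: weight_ideal_0)
next
  case (Suc m)
  show ?case
  proof
    fix p assume "p \<in> ideal_power I (Suc m)"
    then show "p \<in> weight_ideal W (Suc m * d)"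
      unfolding ideal_power_Suc
    proof induction
      case (prod i j)
      then have "i \<in> weight_ideal W (m * d)" "j \<in> weight_ideal W d"
        using Suc assms by auto
      from weight_ideal_mult[OF this] show ?case by (simp add: add.commute)
    next
      case (sum s1 s2)
      then show ?case using weight_ideal_add by simp
    qed
  qed
qed

lemma single_in_ideal_power_Suc:
  assumes "Poly_Mapping.single u 1 \<in> ideal_power I m" "Poly_Mapping.single v 1 \<in> I"
  shows "Poly_Mapping.single (u + v) 1 \<in> ideal_power I (Suc m)"
  using ideal_prod.prod[OF assms, of mpoly_ring] by (simp add: ideal_power_Suc mult_single)

lemma subset_Idl: "S \<subseteq> Idl\<^bsub>mpoly_ring\<^esub> (S :: ('v, 'k::field) mpoly set)"
  by (rule ring.genideal_self[OF ring_mpoly_ring]) simp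

lemma Idl_subset:
  fixes I :: "('v, 'k::field) mpoly set"
  assumes "ideal I mpoly_ring" "S \<subseteq> I"
  shows "Idl\<^bsub>mpoly_ring\<^esub> S \<subseteq> I"
  using assms by (rule ring.genideal_minimal[OF ring_mpoly_ring])

lemma ideal_Idl: "ideal (Idl\<^bsub>mpoly_ring\<^esub> (S :: ('v, 'k::field) mpoly set)) mpoly_ring"
  by (rule ring.genideal_ideal[OF ring_mpoly_ring]) simp

text \<open>Generators have degree 1 outside \<open>F\<close>, which bounds degrees in the power.
  Conversely, a monomial of degree at least \<open>m\<close> outside \<open>F\<close> loses one such
  variable at a time.\<close>

lemma facet_ideal_power:
  fixes F :: "'v::finite set"
  shows "ideal_power (facet_ideal F) m = (weight_ideal (- F) m :: ('v, 'k::field) mpoly set)"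
proof
  have "facet_ideal F \<subseteq> (weight_ideal (- F) 1 :: ('v, 'k) mpoly set)"
    unfolding facet_ideal_def
    by (rule Idl_subset[OF ideal_weight_ideal])
      (auto simp: weight_ideal_def indet_def lookup_single when_def)
  from ideal_power_subset_weight_ideal[OF this, of m]
  show "ideal_power (facet_ideal F) m \<subseteq> (weight_ideal (- F) m :: ('v, 'k) mpoly set)"
    by simp
next
  have ind: "indet i \<in> (facet_ideal F :: ('v, 'k) mpoly set)" if "i \<notin> F" for i
    unfolding facet_ideal_def using that subset_Idl by fastforce
  have mon: "Poly_Mapping.single u 1 \<in> ideal_power (facet_ideal F :: ('v, 'k) mpoly set) m"
    if "m \<le> sum (Poly_Mapping.lookup u) (- F)" for u
    using that
  proof (induction m arbitrary: u)
    case 0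
    show ?case by (simp add: ideal_power_0)
  next
    case (Suc m)
    then have "sum (Poly_Mapping.lookup u) (- F) \<noteq> 0" by linarith
    then obtain i where i: "i \<notin> F" "Poly_Mapping.lookup u i \<noteq> 0"
      by (metis ComplD sum.neutral)
    define v where "v = u - Poly_Mapping.single i 1"
    have u: "u = v + Poly_Mapping.single i 1"
      using i(2) unfolding v_def
      by (intro poly_mapping_eqI) (auto simp: lookup_add lookup_minus lookup_single when_def)
    have "m \<le> sum (Poly_Mapping.lookup v) (- F)"
      using Suc.prems i(1)
      by (simp add: u lookup_add lookup_single when_def sum.distrib)
    then have "Poly_Mapping.single v 1 \<in> ideal_power (facet_ideal F :: ('v, 'k) mpoly set) m"
      by (rule Suc.IH)
    then show ?case
      using single_in_ideal_power_Suc ind[OF i(1)] unfolding u indet_def by blast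
  qed
  have ideal: "ideal (facet_ideal F :: ('v, 'k) mpoly set) mpoly_ring"
    unfolding facet_ideal_def by (rule ideal_Idl)
  show "(weight_ideal (- F) m :: ('v, 'k) mpoly set) \<subseteq> ideal_power (facet_ideal F) m"
  proof
    fix p :: "('v, 'k) mpoly"
    assume "p \<in> weight_ideal (- F) m"
    then have "m \<le> sum (Poly_Mapping.lookup u) (- F)" if "u \<in> Poly_Mapping.keys p" for u
      using that by (simp add: weight_ideal_def)
    then show "p \<in> ideal_power (facet_ideal F) m"
      by (rule monomials_in_ideal[OF ideal_ideal_power[OF ideal] mon])
  qed
qed

section \<open>Nonfaces as vertex covers, and ordinary versus symbolic powers\<close>

text \<open>Every face extends to a maximal one, so a nonface is a set contained in no
  facet.\<close>

lemma nonface_iff_facets: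
  fixes \<Delta> :: "'v::finite set set"
  assumes "simplicial_complex \<Delta>"
  shows "S \<notin> \<Delta> \<longleftrightarrow> (\<forall>F\<in>facets \<Delta>. S \<inter> - F \<noteq> {})"
proof -
  have "\<exists>F\<in>facets \<Delta>. S \<subseteq> F" if S: "S \<in> \<Delta>"
  proof -
    obtain F where "F \<in> \<Delta>" "S \<subseteq> F" "\<And>G. G \<in> \<Delta> \<Longrightarrow> F \<subseteq> G \<Longrightarrow> F = G"
      using finite_has_maximal2[OF finite S] by metis
    then have "F \<in> facets \<Delta>" unfolding facets_def by blast
    with \<open>S \<subseteq> F\<close> show ?thesis by blast
  qed
  moreover have "F \<in> facets \<Delta> \<Longrightarrow> S \<subseteq> F \<Longrightarrow> S \<in> \<Delta>" for F
    using assms unfolding facets_def simplicial_complex_def by blast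
  ultimately show ?thesis by blast
qed

lemma symbolic_power_weight:
  "symbolic_power \<Delta> m = (\<Inter>F\<in>facets \<Delta>. weight_ideal (- F) m)"
  by (simp add: symbolic_power_def facet_ideal_power)

lemma ideal_stanley_reisner_ideal:
  "ideal (stanley_reisner_ideal \<Delta> :: ('v::finite, 'k::field) mpoly set) mpoly_ring"
  unfolding stanley_reisner_ideal_def by (rule ideal_Idl)

lemma nonface_monomial_in_stanley_reisner_ideal:
  assumes "S \<notin> \<Delta>"
  shows "Poly_Mapping.single (set_exponent S) 1 \<in> (stanley_reisner_ideal \<Delta> :: ('v::finite, 'k::field) mpoly set)"
  unfolding stanley_reisner_ideal_def using assms subset_Idl
  by (fastforce simp flip: prod_indet)

text \<open>The generator of a nonface \<open>S\<close> is squarefree, so its degree in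
  \<open>W\<close> is \<open>card (S \<inter> W)\<close>.\<close>

lemma stanley_reisner_ideal_subset_weight_ideal:
  fixes \<Delta> :: "'v::finite set set"
  assumes "\<And>S. S \<notin> \<Delta> \<Longrightarrow> t \<le> card (S \<inter> W)"
  shows "(stanley_reisner_ideal \<Delta> :: ('v, 'k::field) mpoly set) \<subseteq> weight_ideal W t"
  unfolding stanley_reisner_ideal_def
proof (rule Idl_subset[OF ideal_weight_ideal])
  have "sum (Poly_Mapping.lookup (set_exponent S)) W = card (S \<inter> W)" for S :: "'v set"
    by (simp add: lookup_set_exponent sum.If_cases Int_commute)
  then show "{\<Prod>i\<in>S. indet i | S. S \<notin> \<Delta>} \<subseteq> (weight_ideal W t :: ('v, 'k) mpoly set)"
    using assms by (auto simp: prod_indet weight_ideal_def)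
qed

lemma ideal_power_subset_symbolic_power:
  fixes \<Delta> :: "'v::finite set set"
  assumes "simplicial_complex \<Delta>"
  shows "ideal_power (stanley_reisner_ideal \<Delta> :: ('v, 'k::field) mpoly set) m
    \<subseteq> symbolic_power \<Delta> m"
  unfolding symbolic_power_weight
proof (rule INT_greatest)
  fix F assume F: "F \<in> facets \<Delta>"
  have "1 \<le> card (S \<inter> - F)" if "S \<notin> \<Delta>" for S
    using that F nonface_iff_facets[OF assms] by (simp add: Suc_le_eq card_gt_0_iff)
  from ideal_power_subset_weight_ideal[OF stanley_reisner_ideal_subset_weight_ideal[OF this]]
  show "ideal_power (stanley_reisner_ideal \<Delta> :: ('v, 'k) mpoly set) m \<subseteq> weight_ideal (- F) m"
    by (metis mult.right_neutral)
qed

section \<open>Equality of powers for bipartite graphs\<close>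

lemma two_element_transversal:
  fixes F :: "'v::finite set"
  assumes "card (- F) = 2" "A \<union> B = UNIV" "A \<inter> B = {}" "A \<inter> - F \<noteq> {}" "B \<inter> - F \<noteq> {}"
  obtains a b where "a \<in> A" "b \<in> B" "- F = {a, b}" "a \<noteq> b"
proof -
  obtain a b where "a \<in> A" "b \<in> B" "a \<in> - F" "b \<in> - F" using assms by blast
  moreover from this have "a \<noteq> b" using assms by blast
  ultimately have "{a, b} = - F" using assms(1)
    by (intro card_subset_eq) auto
  with that show ?thesis using \<open>a \<in> A\<close> \<open>b \<in> B\<close> \<open>a \<noteq> b\<close> by metis
qed

text \<open>Induction on \<open>m\<close>: each step splits a nonface monomial off the exponent
  vector and keeps enough weight on every edge.\<close>

lemma symbolic_power_eq_if_partition: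
  fixes \<Delta> :: "'v::finite set set"
  assumes sc: "simplicial_complex \<Delta>"
    and card: "\<And>F. F \<in> facets \<Delta> \<Longrightarrow> card (- F) = 2"
    and AB: "A \<union> B = UNIV" "A \<inter> B = {}" "A \<notin> \<Delta>" "B \<notin> \<Delta>"
  shows "symbolic_power \<Delta> m = ideal_power (stanley_reisner_ideal \<Delta> :: ('v, 'k::field) mpoly set) m"
proof
  let ?I = "stanley_reisner_ideal \<Delta> :: ('v, 'k) mpoly set"
  have edge: "\<exists>a\<in>A. \<exists>b\<in>B. - F = {a, b} \<and> a \<noteq> b" if "F \<in> facets \<Delta>" for F
  proof -
    have "A \<inter> - F \<noteq> {}" "B \<inter> - F \<noteq> {}"
      using AB(3,4) that nonface_iff_facets[OF sc] by blast+
    from two_element_transversal[OF card[OF that] AB(1,2) this] show ?thesis by metis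
  qed
  have mon: "Poly_Mapping.single u 1 \<in> ideal_power ?I m"
    if "\<And>F. F \<in> facets \<Delta> \<Longrightarrow> m \<le> sum (Poly_Mapping.lookup u) (- F)" for u
    using that
  proof (induction m arbitrary: u)
    case 0
    show ?case by (simp add: ideal_power_0)
  next
    case (Suc m)
    \<comment> \<open>On an edge \<open>ab\<close> of weight at least m + 1, either \<open>a\<close>
      has positive exponent or \<open>b\<close> has exponent at least m + 1, so \<open>C\<close>
      meets the edge. If only one end is in \<open>C\<close>, the weight drops by 1; if both are,
      \<open>b\<close> alone keeps weight m.\<close>
    define C where "C = {a \<in> A. 1 \<le> Poly_Mapping.lookup u a} \<union> {b \<in> B. Suc m \<le> Poly_Mapping.lookup u b}"
    define v where "v = u - set_exponent C"
    \<comment> \<open>Exponents on \<open>C\<close> are positive, so the truncated subtraction loses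
      nothing.\<close>
    have u: "u = v + set_exponent C"
      unfolding v_def
      by (intro poly_mapping_eqI) (auto simp: lookup_add lookup_minus lookup_set_exponent C_def)
    have ab: "C \<inter> - F \<noteq> {} \<and> m \<le> sum (Poly_Mapping.lookup v) (- F)" if F: "F \<in> facets \<Delta>" for F
    proof -
      obtain a b where *: "a \<in> A" "b \<in> B" "- F = {a, b}" "a \<noteq> b"
        using edge[OF F] by blast
      have "a \<notin> B" "b \<notin> A" using * AB by auto
      moreover have "Suc m \<le> Poly_Mapping.lookup u a + Poly_Mapping.lookup u b"
        using Suc.prems[OF F] * by simp
      ultimately show ?thesis using *
        by (auto simp: C_def v_def lookup_minus lookup_set_exponent)
    qed
    then have "C \<notin> \<Delta>" using nonface_iff_facets[OF sc] by blast
    moreover have "Poly_Mapping.single v 1 \<in> ideal_power ?I m"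
      using ab by (intro Suc.IH) blast
    ultimately show ?case
      using single_in_ideal_power_Suc nonface_monomial_in_stanley_reisner_ideal unfolding u by blast
  qed
  show "symbolic_power \<Delta> m \<subseteq> ideal_power ?I m"
  proof
    fix p :: "('v, 'k) mpoly"
    assume "p \<in> symbolic_power \<Delta> m"
    then have "m \<le> sum (Poly_Mapping.lookup u) (- F)"
      if "u \<in> Poly_Mapping.keys p" "F \<in> facets \<Delta>" for u F
      using that by (simp add: symbolic_power_weight weight_ideal_def)
    then show "p \<in> ideal_power ?I m"
      by (rule monomials_in_ideal[OF ideal_ideal_power[OF ideal_stanley_reisner_ideal] mon])
  qed
  show "ideal_power ?I m \<subseteq> symbolic_power \<Delta> m"
    by (rule ideal_power_subset_symbolic_power[OF sc])
qed

section \<open>Failure of equality in the presence of an odd cycle\<close>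

text \<open>The exponents on \<open>W\<close> cannot all be \<open>m/2\<close> for odd \<open>m\<close>: they are rounded down on the
  independent set \<open>Z\<close> and up elsewhere.\<close>

lemma symbolic_power_neq_if_odd_cover:
  fixes \<Delta> :: "'v::finite set set"
  assumes card: "\<And>F. F \<in> facets \<Delta> \<Longrightarrow> card (- F) = 2"
    and W: "card W = 2 * t - 1" "\<And>S. S \<notin> \<Delta> \<Longrightarrow> t \<le> card (S \<inter> W)" "0 < t"
    and Z: "Z \<subseteq> W" "card Z = t - 1" "\<And>F. F \<in> facets \<Delta> \<Longrightarrow> \<not> - F \<subseteq> Z"
    and m: "2 \<le> m"
  shows "symbolic_power \<Delta> m \<noteq> ideal_power (stanley_reisner_ideal \<Delta> :: ('v, 'k::field) mpoly set) m"
proof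
  let ?I = "stanley_reisner_ideal \<Delta> :: ('v, 'k) mpoly set"
  \<comment> \<open>The value \<open>m\<close> outside \<open>W\<close> takes care of all edges
    leaving \<open>W\<close>. An edge inside \<open>W\<close> has at most one end in
    \<open>Z\<close>, so its weight is at least the sum of the two halves, which is
    \<open>m\<close>.\<close>
  define h where "h i = (if i \<in> Z then m div 2 else if i \<in> W then (m + 1) div 2 else m)" for i
  define u where "u = Abs_poly_mapping h"
  have u: "Poly_Mapping.lookup u = h"
    by (simp add: u_def)
  have "m \<le> sum h (- F)" if F: "F \<in> facets \<Delta>" for F
  proof -
    obtain x y where xy: "- F = {x, y}" "x \<noteq> y"
      using card[OF F] by (metis card_2_iff)
    then have "x \<notin> Z \<or> y \<notin> Z" using Z(3)[OF F] by auto
    then show ?thesis using xy by (auto simp: h_def)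
  qed
  then have "Poly_Mapping.single u 1 \<in> (symbolic_power \<Delta> m :: ('v, 'k) mpoly set)"
    by (simp add: symbolic_power_weight weight_ideal_def u)
  moreover assume "symbolic_power \<Delta> m = ideal_power ?I m"
  moreover have "ideal_power ?I m \<subseteq> weight_ideal W (m * t)"
    using stanley_reisner_ideal_subset_weight_ideal[OF W(2)] by (rule ideal_power_subset_weight_ideal)
  ultimately have "Poly_Mapping.single u (1::'k) \<in> weight_ideal W (m * t)" by auto
  then have "m * t \<le> sum h W" by (simp add: weight_ideal_def u)
  also have "sum h W = (t - 1) * (m div 2) + t * ((m + 1) div 2)"
  proof -
    have "sum h W = sum h Z + sum h (W - Z)"
      using Z(1) by (metis add.commute finite sum.subset_diff)
    also have "sum h Z = (t - 1) * (m div 2)" by (simp add: h_def Z(2))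
    also have "sum h (W - Z) = card (W - Z) * ((m + 1) div 2)" by (simp add: h_def)
    also have "card (W - Z) = t" using W(1,3) Z(1,2) by (simp add: card_Diff_subset)
    finally show ?thesis .
  qed
  \<comment> \<open>Strict because \<open>m div 2\<close> is positive for
    \<open>m \<ge> 2\<close>.\<close>
  also have "\<dots> < t * (m div 2) + t * ((m + 1) div 2)"
    using W(3) m by simp
  also have "\<dots> = t * (m div 2 + (m + 1) div 2)" by (simp add: algebra_simps)
  also have "m div 2 + (m + 1) div 2 = m" by simp
  finally show False by (simp add: mult.commute)
qed

section \<open>Graphs on five vertices without odd cycles\<close>

text \<open>Without 3- and 5-cycles the graph is bipartite. The last assumption says that no single
  vertex meets all edges, which excludes parts of sizes 1 and 4 or 0 and 5; the remaining sizes are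
  2 and 3.\<close>

lemma no_odd_cycle_imp_bipartition_2_3:
  fixes E :: "'a \<Rightarrow> 'a \<Rightarrow> bool" and a b c d e :: 'a
  assumes sym: "\<And>x y. E x y = E y x"
    and dist: "distinct [a, b, c, d, e]" and univ: "UNIV = {a, b, c, d, e}"
    and tri: "\<And>x y z. distinct [x, y, z] \<Longrightarrow> \<not> (E x y \<and> E y z \<and> E z x)"
    and pent: "\<And>v w x y z. distinct [v, w, x, y, z] \<Longrightarrow> \<not> (E v w \<and> E w x \<and> E x y \<and> E y z \<and> E z v)"
    and star: "\<And>x. \<exists>y z. distinct [x, y, z] \<and> E y z"
  shows "\<exists>x y. x \<noteq> y \<and> \<not> E x y \<and> (\<forall>v w. distinct [v, w, x, y] \<longrightarrow> \<not> E v w)"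
proof -
  have all: "(\<forall>x. P x) \<longleftrightarrow> P a \<and> P b \<and> P c \<and> P d \<and> P e" for P :: "'a \<Rightarrow> bool"
    using univ by (metis UNIV_I empty_iff insert_iff)
  have ex: "(\<exists>x. P x) \<longleftrightarrow> P a \<or> P b \<or> P c \<or> P d \<or> P e" for P :: "'a \<Rightarrow> bool"
    using all[of "\<lambda>x. \<not> P x"] by blast
  have neq: "a \<noteq> b" "a \<noteq> c" "a \<noteq> d" "a \<noteq> e" "b \<noteq> c" "b \<noteq> d" "b \<noteq> e" "c \<noteq> d" "c \<noteq> e" "d \<noteq> e"
    using dist by auto
  note E = sym[of b a] sym[of c a] sym[of d a] sym[of e a] sym[of c b] sym[of d b] sym[of e b]
    sym[of d c] sym[of e c] sym[of e d]
  note reduce = neq neq[symmetric] E distinct.simps list.set insert_iff empty_iff simp_thms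
  \<comment> \<open>All ten triangles and all twelve Hamiltonian cycles, the latter started at
    \<open>a\<close> and taken up to reversal.\<close>
  note no_cycles =
    tri[of a b c] tri[of a b d] tri[of a b e] tri[of a c d] tri[of a c e]
    tri[of a d e] tri[of b c d] tri[of b c e] tri[of b d e] tri[of c d e]
    pent[of a b c d e] pent[of a b c e d] pent[of a b d c e] pent[of a b d e c]
    pent[of a b e c d] pent[of a b e d c] pent[of a c b d e] pent[of a c b e d]
    pent[of a c d b e] pent[of a c e b d] pent[of a d b c e] pent[of a d c b e]
  note no_cycles = no_cycles[simplified reduce]
  note stars = star[of a] star[of b] star[of c] star[of d] star[of e]
  note stars = stars[unfolded ex, simplified reduce]
  show ?thesis
  proof (rule ccontr)
    assume "\<not> ?thesis"
    then have "x = y \<or> E x y \<or> (\<exists>v w. distinct [v, w, x, y] \<and> E v w)" for x y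
      by blast
    note n = this[unfolded ex]
    note edges =
      n[of a b] n[of a c] n[of a d] n[of a e] n[of b c]
      n[of b d] n[of b e] n[of c d] n[of c e] n[of d e]
    note edges = edges[simplified reduce]
    show False
      \<comment> \<open>Only ten atoms remain, one for each unordered pair of vertices.\<close>
      using stars edges no_cycles by sat
  qed
qed

section \<open>Pure complexes and the equivalence\<close>

text \<open>A face of top dimension exists and is a facet; purity gives every other facet the same
  dimension.\<close>

lemma facets_pure:
  fixes \<Delta> :: "'v::finite set set"
  assumes "pure_complex \<Delta>" "\<Delta> \<noteq> {}"
  shows "F \<in> facets \<Delta> \<longleftrightarrow> F \<in> \<Delta> \<and> face_dim F = complex_dim \<Delta>"
proof -
  have le: "face_dim G \<le> complex_dim \<Delta>" if "G \<in> \<Delta>" for G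
    using that by (simp add: complex_dim_def)
  have facetI: "G \<in> facets \<Delta>" if G: "G \<in> \<Delta>" "face_dim G = complex_dim \<Delta>" for G
  proof -
    have "H = G" if "H \<in> \<Delta>" "G \<subseteq> H" for H
      using le[OF that(1)] G(2) that(2) by (intro card_seteq[symmetric]) (auto simp: face_dim_def)
    with G(1) show ?thesis by (simp add: facets_def)
  qed
  have "complex_dim \<Delta> \<in> face_dim ` \<Delta>"
    unfolding complex_dim_def using assms(2) by (intro Max_in) auto
  then obtain G where G: "G \<in> \<Delta>" "face_dim G = complex_dim \<Delta>"
    by auto
  have "face_dim F = complex_dim \<Delta>" if "F \<in> facets \<Delta>"
    using assms(1) that facetI[OF G] G(2) unfolding pure_complex_def by metis
  with facetI show ?thesis by (auto simp: facets_def)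
qed

theorem theorem2p1:
  fixes \<Delta> :: "'v::finite set set"
  assumes "CARD('v) = 5"
    and "simplicial_complex \<Delta>"
    and "pure_complex \<Delta>"
    and "complex_dim \<Delta> = 2"
  shows
    "((\<exists>m\<ge>2. symbolic_power \<Delta> m =
          ideal_power (stanley_reisner_ideal \<Delta> :: ('v, 'k::field) mpoly set) m)
      \<longleftrightarrow>
      (\<forall>m\<ge>2. symbolic_power \<Delta> m =
          ideal_power (stanley_reisner_ideal \<Delta> :: ('v, 'k) mpoly set) m))
     \<and>
     ((\<forall>m\<ge>2. symbolic_power \<Delta> m =
          ideal_power (stanley_reisner_ideal \<Delta> :: ('v, 'k) mpoly set) m)
      \<longleftrightarrow>
      (\<exists>A B. A \<union> B = UNIV \<and> A \<inter> B = {} \<and> A \<notin> \<Delta> \<and> B \<notin> \<Delta> \<and> card A = 2 \<and> card B = 3))"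
proof -
  let ?eq = "\<lambda>m. symbolic_power \<Delta> m = ideal_power (stanley_reisner_ideal \<Delta> :: ('v, 'k) mpoly set) m"
  let ?part = "\<exists>A B. A \<union> B = UNIV \<and> A \<inter> B = {} \<and> A \<notin> \<Delta> \<and> B \<notin> \<Delta> \<and> card A = 2 \<and> card B = 3"
  have "\<Delta> \<noteq> {}" using assms(2) by (auto simp: simplicial_complex_def)
  then have facet: "F \<in> facets \<Delta> \<longleftrightarrow> F \<in> \<Delta> \<and> card F = 3" for F
    using facets_pure[OF assms(3)] assms(4) by (auto simp: face_dim_def)
  have card_Compl: "card (- S) = 5 - card S" for S :: "'v set"
    using assms(1) by (simp add: Compl_eq_Diff_UNIV card_Diff_subset)
  with facet have card: "card (- F) = 2" if "F \<in> facets \<Delta>" for F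
    using that by simp
  \<comment> \<open>For \<open>x \<noteq> y\<close> the set \<open>- {x, y}\<close> has three
    elements, so as a face it is a facet: \<open>E\<close> is the graph of facet
    complements.\<close>
  define E where "E x y \<longleftrightarrow> - {x, y} \<in> \<Delta>" for x y
  have E_sym: "E x y = E y x" for x y
    by (simp add: E_def insert_commute)
  have facet_E: "\<exists>x y. - F = {x, y} \<and> x \<noteq> y \<and> E x y" if F: "F \<in> facets \<Delta>" for F
  proof -
    obtain x y where "- F = {x, y}" "x \<noteq> y"
      using card[OF F] by (metis card_2_iff)
    moreover from this have "- {x, y} = F" by blast
    ultimately show ?thesis using F unfolding E_def facet by metis
  qed
  have E_facet: "- {x, y} \<in> facets \<Delta>" if "E x y" "x \<noteq> y" for x y
    using that unfolding E_def facet by (simp add: card_Compl)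
  have nonface_E: "x \<in> S \<or> y \<in> S" if "S \<notin> \<Delta>" "E x y" "x \<noteq> y" for S x y
    using nonface_iff_facets[OF assms(2)] that(1) E_facet[OF that(2,3)] by fastforce
  have face_facet: "\<exists>F\<in>facets \<Delta>. S \<subseteq> F" if "S \<in> \<Delta>" for S
    using that nonface_iff_facets[OF assms(2), of S] by (auto simp: disjoint_eq_subset_Compl)
  have part_eq: "?eq m" if ?part for m
  proof -
    from that obtain A B where "A \<union> B = UNIV" "A \<inter> B = {}" "A \<notin> \<Delta>" "B \<notin> \<Delta>"
      by blast
    from symbolic_power_eq_if_partition[OF assms(2) card this] show ?thesis .
  qed
  have eq_part: ?part if m: "2 \<le> m" and eq: "?eq m" for m
  proof -
    obtain xs :: "'v list" where xs: "set xs = UNIV" "distinct xs"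
      using finite_distinct_list[OF finite] by blast
    then have "length xs = 5" using assms(1) distinct_card by metis
    then obtain a b c d e where "xs = [a, b, c, d, e]"
      by (auto simp: numeral_eq_Suc length_Suc_conv)
    with xs have abcde: "distinct [a, b, c, d, e]" "UNIV = {a, b, c, d, e}" by auto
    have tri: "\<not> (E x y \<and> E y z \<and> E z x)" if xyz: "distinct [x, y, z]" for x y z
    proof
      assume E: "E x y \<and> E y z \<and> E z x"
      have S: "2 \<le> card (S \<inter> {x, y, z})" if "S \<notin> \<Delta>" for S
      proof -
        have "{x, y} \<subseteq> S \<inter> {x, y, z} \<or> {y, z} \<subseteq> S \<inter> {x, y, z} \<or> {z, x} \<subseteq> S \<inter> {x, y, z}"
          using nonface_E[OF that, of x y] nonface_E[OF that, of y z] nonface_E[OF that, of z x]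
            E xyz by auto
        moreover have "card {x, y} = 2" "card {y, z} = 2" "card {z, x} = 2" using xyz by auto
        ultimately show ?thesis by (metis card_mono finite)
      qed
      have "\<not> - F \<subseteq> {x}" if "F \<in> facets \<Delta>" for F
        using card_mono[of "{x}" "- F"] card[OF that] by auto
      then have "\<not> ?eq m"
        using card S m xyz
        by (intro symbolic_power_neq_if_odd_cover[where W = "{x, y, z}" and Z = "{x}" and t = 2]) simp_all
      with eq show False by simp
    qed
    have pent: "\<not> (E v w \<and> E w x \<and> E x y \<and> E y z \<and> E z v)"
      if vz: "distinct [v, w, x, y, z]" for v w x y z
    proof
      assume E: "E v w \<and> E w x \<and> E x y \<and> E y z \<and> E z v"
      have S: "3 \<le> card (S \<inter> {v, w, x, y, z})" if "S \<notin> \<Delta>" for S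
      proof -
        let ?T = "S \<inter> {v, w, x, y, z}"
        \<comment> \<open>These are the five minimal vertex covers of the 5-cycle.\<close>
        have "{v, w, y} \<subseteq> ?T \<or> {v, x, y} \<subseteq> ?T \<or> {v, x, z} \<subseteq> ?T \<or> {w, x, z} \<subseteq> ?T \<or> {w, y, z} \<subseteq> ?T"
          using nonface_E[OF that, of v w] nonface_E[OF that, of w x] nonface_E[OF that, of x y]
            nonface_E[OF that, of y z] nonface_E[OF that, of z v] E vz by auto
        moreover have "card {v, w, y} = 3" "card {v, x, y} = 3" "card {v, x, z} = 3"
          "card {w, x, z} = 3" "card {w, y, z} = 3" using vz by auto
        ultimately show ?thesis by (metis card_mono finite)
      qed
      \<comment> \<open>Triangles are already excluded, so the pentagon has no chord and
        \<open>{v, x}\<close> can serve as the independent set.\<close>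
      have "\<not> E v x" using tri[of v w x] E E_sym vz by auto
      have "\<not> - F \<subseteq> {v, x}" if F: "F \<in> facets \<Delta>" for F
      proof
        assume "- F \<subseteq> {v, x}"
        moreover obtain p q where "- F = {p, q}" "p \<noteq> q" "E p q" using facet_E[OF F] by metis
        ultimately show False using \<open>\<not> E v x\<close> E_sym by auto
      qed
      then have "\<not> ?eq m"
        using card S m vz
        by (intro symbolic_power_neq_if_odd_cover[where W = "{v, w, x, y, z}" and Z = "{v, x}" and t = 3]) simp_all
      with eq show False by simp
    qed
    \<comment> \<open>The vertex \<open>x\<close> lies in some facet, whose complement is an edge
      avoiding \<open>x\<close>.\<close>
    have star: "\<exists>y z. distinct [x, y, z] \<and> E y z" for x
    proof -
      have "{x} \<in> \<Delta>" using assms(2) by (simp add: simplicial_complex_def)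
      then obtain F where F: "F \<in> facets \<Delta>" "x \<in> F"
        using face_facet by blast
      obtain y z where yz: "- F = {y, z}" "y \<noteq> z" "E y z" using facet_E[OF F(1)] by metis
      have "x \<notin> {y, z}" using F(2) unfolding yz(1)[symmetric] by simp
      with yz(2,3) have "distinct [x, y, z] \<and> E y z" by simp
      then show ?thesis by blast
    qed
    obtain x y where xy: "x \<noteq> y" "\<not> E x y" "\<And>v w. distinct [v, w, x, y] \<Longrightarrow> \<not> E v w"
      using no_odd_cycle_imp_bipartition_2_3[of E, OF E_sym abcde tri pent star] by blast
    \<comment> \<open>A facet containing both vertices would have as complement an edge disjoint
      from \<open>{x, y}\<close>.\<close>
    have "{x, y} \<notin> \<Delta>"
    proof
      assume "{x, y} \<in> \<Delta>"
      then obtain F where F: "F \<in> facets \<Delta>" "{x, y} \<subseteq> F"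
        using face_facet by blast
      obtain v w where vw: "- F = {v, w}" "v \<noteq> w" "E v w" using facet_E[OF F(1)] by metis
      have "{x, y} \<inter> {v, w} = {}" using F(2) unfolding vw(1)[symmetric] by blast
      with xy(1) vw(2) have "distinct [v, w, x, y]" by auto
      with vw(3) xy(3) show False by blast
    qed
    moreover have "- {x, y} \<notin> \<Delta>" using xy(2) by (simp add: E_def)
    moreover have "card {x, y} = 2" "card (- {x, y}) = 3"
      using xy(1) by (simp_all add: card_Compl)
    ultimately show ?part
      by (intro exI[of _ "{x, y}"] exI[of _ "- {x, y}"]) auto
  qed
  have "(\<exists>m\<ge>2. ?eq m) \<longrightarrow> ?part"
    using eq_part by (intro impI) (elim exE conjE)
  moreover have "?part \<longrightarrow> (\<forall>m\<ge>2. ?eq m)"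
    using part_eq by (intro impI allI)
  moreover have "(\<forall>m\<ge>2. ?eq m) \<longrightarrow> (\<exists>m\<ge>2. ?eq m)"
    by (intro impI exI[of _ 2]) simp
  ultimately show ?thesis by sat
qed

end
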